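(* Let $\{a_1, \dots, a_n\} \subset \mathbb{N}$ be a set of $n$ positive integers, $a_1 < a_2 < \dots < a_n$, such that the $2^n$ subsets have pairwise distinct sums. Then, as $n \to \infty$, $$ a_n \geq \left(1-o(1)\right) \cdot \sqrt{\frac{2}{\pi}}\,\frac{2^{n}}{\sqrt{n}}.$$ That is: for every $\eta > 0$ there is an $N$ such that for all $n \geq N$ and every such set, $a_n \geq (1-\eta) \sqrt{2/\pi}\; 2^n/\sqrt{n}$.
   Context: Distinct subset sums means that for any two distinct subsets $S, T \subseteq \{1,\dots,n\}$ (the empty set allowed, with sum $0$) one has $\sum_{i \in S} a_i \neq \sum_{i \in T} a_i$. *)

theory Defs
  imports Complex_Main
begin

(* Only the values a 1, ..., a n matter. *)
definition distinct_subset_sums :: "nat \<Rightarrow> (nat \<Rightarrow> nat) \<Rightarrow> bool" where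
  "distinct_subset_sums n a \<longleftrightarrow>
     (\<forall>S T. S \<subseteq> {1..n} \<longrightarrow> T \<subseteq> {1..n} \<longrightarrow> S \<noteq> T \<longrightarrow> (\<Sum>i\<in>S. a i) \<noteq> (\<Sum>i\<in>T. a i))"

end

theory Submission
  imports Defs "HOL-Analysis.Gamma_Function" "HOL-Real_Asymp.Real_Asymp"
begin

text \<open>The subsets of \<open>{1..n}\<close> whose sum is less than half the total form a down-set of size \<open>2^(n-1)\<close>.
  The sums of the sets in its vertex boundary lie in an interval of length \<open>a n\<close> starting at half
  the total, so \<open>a n\<close> bounds the size of the boundary. By Harper's vertex-isoperimetric inequality
  the boundary is at least as large as that of a Hamming ball of the same size, about the central
  binomial coefficient, which Wallis' product estimates.

  Harper's inequality is needed only for down-sets and in the form that interpolates linearly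
  between consecutive Hamming balls. In the induction on the dimension, let \<open>m0 \<ge> m1\<close> be the sizes
  of the two halves of the family and \<open>h\<close> the interpolated bound one dimension lower. The bound
  \<open>h m0 + max (h m1) m0\<close> suffices: it is tight for the split with \<open>m0 = h m1\<close>; for a larger \<open>m0\<close> the
  second option of the maximum is enough, and for a smaller one concavity of \<open>h\<close> is.\<close>

section \<open>Down-sets, their neighbourhoods and Hamming balls in the cube\<close>

definition down_closed :: "'a set set \<Rightarrow> bool" where
  "down_closed F \<longleftrightarrow> (\<forall>X\<in>F. \<forall>Y\<subseteq>X. Y \<in> F)"

text \<open>Upward steps suffice: deleting an element never leaves a down-set, so for down-sets this
  is the full closed vertex neighbourhood in the cube on \<open>S\<close>.\<close>

definition up_nbhd :: "'a set \<Rightarrow> 'a set set \<Rightarrow> 'a set set" where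
  "up_nbhd S F = F \<union> {insert x X | x X. x \<in> S \<and> X \<in> F}"

text \<open>The index \<open>k\<close> counts layers and is not the radius: the ball consists of the
  sets with fewer than \<open>k\<close> elements, and \<open>k = 0\<close> gives the empty
  ball.\<close>

definition hamming_ball_card :: "nat \<Rightarrow> nat \<Rightarrow> nat" where
  "hamming_ball_card n k = (\<Sum>i<k. n choose i)"

lemma hamming_ball_card_0 [simp]: "hamming_ball_card n 0 = 0"
  by (simp add: hamming_ball_card_def)

lemma hamming_ball_card_Suc:
  "hamming_ball_card n (Suc k) = hamming_ball_card n k + (n choose k)"
  by (simp add: hamming_ball_card_def)

lemma hamming_ball_card_pascal:
  "hamming_ball_card (Suc n) (Suc k) = hamming_ball_card n (Suc k) + hamming_ball_card n k"
  by (induction k) (simp_all add: hamming_ball_card_Suc)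

lemma hamming_ball_card_empty_cube: "hamming_ball_card 0 (Suc k) = 1"
  by (induction k) (simp_all add: hamming_ball_card_Suc)

lemma up_nbhd_subset_Pow: "F \<subseteq> Pow S \<Longrightarrow> up_nbhd S F \<subseteq> Pow S"
  by (auto simp: up_nbhd_def)

section \<open>Slopes of the interpolated bound and their concavity\<close>

lemma choose_Suc_ratio:
  "real (n choose Suc k) = real (n - k) / real (Suc k) * real (n choose k)"
proof -
  have "Suc k * (n choose Suc k) = (n - k) * (n choose k)"
    by (metis binomial_absorb_comp binomial_absorption)
  then have "real (Suc k) * real (n choose Suc k) = real (n - k) * real (n choose k)"
    by (metis of_nat_mult)
  then show ?thesis
    by (simp add: field_simps del: of_nat_Suc)
qed

text \<open>These ratios are the slopes of the interpolated bound on consecutive layers; their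
  decrease (log-concavity of binomial coefficients) makes the bound concave.\<close>

lemma choose_ratio_antimono:
  "real (n - Suc k) / real (Suc (Suc k)) \<le> real (n - k) / real (Suc k)"
  by (intro frac_le) auto

text \<open>Let \<open>g\<close> have slope \<sigma> left of 0 and \<tau> right of 0, with
  \<open>g 0 = 0\<close>. It is concave and nondecreasing, so a pair that is less spread out and has
  at least the same sum gives a larger \<open>g\<close>-sum. The left side is
  \<open>g z0 + g z1\<close>.\<close>

lemma concave_two_piece:
  fixes \<sigma> \<tau> y0 y1 z0 z1 :: real
  assumes "0 \<le> \<tau>" "\<tau> \<le> \<sigma>" "z1 \<le> 0" "0 \<le> z0" "z1 \<le> y1" "y1 \<le> y0" "y0 \<le> z0"
    and s: "z0 + z1 \<le> y0 + y1"
  shows "\<tau> * z0 + \<sigma> * z1 \<le> (if y0 \<le> 0 then \<sigma> else \<tau>) * y0 + (if y1 \<le> 0 then \<sigma> else \<tau>) * y1"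
proof -
  have z0: "\<tau> * z0 \<le> \<sigma> * z0" and z1: "\<sigma> * z1 \<le> \<tau> * z1"
    using assms by (auto intro: mult_right_mono mult_right_mono_neg)
  have S: "\<sigma> * z0 + \<sigma> * z1 \<le> \<sigma> * y0 + \<sigma> * y1" and T: "\<tau> * z0 + \<tau> * z1 \<le> \<tau> * y0 + \<tau> * y1"
    using mult_left_mono[OF s, of \<sigma>] mult_left_mono[OF s, of \<tau>] assms
    by (auto simp: distrib_left)
  \<comment> \<open>The case of mixed signs: moving from \<open>z0\<close> down to \<open>y0\<close>
    costs at most slope \<tau>, moving from \<open>z1\<close> up to \<open>y1\<close> gains slope
    \<sigma>.\<close>
  have "\<tau> * (z0 - y0) \<le> \<sigma> * (z0 - y0)" "\<sigma> * (z0 - y0) \<le> \<sigma> * (y1 - z1)"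
    using assms by (auto intro: mult_right_mono mult_left_mono)
  then have M: "\<tau> * z0 + \<sigma> * z1 \<le> \<tau> * y0 + \<sigma> * y1"
    by (simp add: algebra_simps)
  show ?thesis
    using z0 z1 S T M assms by auto
qed

section \<open>Harper's inequality for down-sets, by induction on the dimension\<close>

lemma card_family_insert:
  assumes "finite S" "a \<notin> S" "F \<subseteq> Pow (insert a S)"
  shows "card F = card {X \<in> F. a \<notin> X} + card {X. X \<subseteq> S \<and> insert a X \<in> F}"
proof -
  let ?G = "{X. X \<subseteq> S \<and> insert a X \<in> F}"
  have fin: "finite F"
    using assms by (meson finite_Pow_iff finite_insert finite_subset)
  have "{X \<in> F. a \<in> X} = insert a ` ?G"
  proof
    show "{X \<in> F. a \<in> X} \<subseteq> insert a ` ?G"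
    proof
      fix X assume X: "X \<in> {X \<in> F. a \<in> X}"
      then have "X = insert a (X - {a})" "X - {a} \<in> ?G"
        using assms by (auto simp: insert_absorb)
      then show "X \<in> insert a ` ?G" by blast
    qed
  qed auto
  moreover have "inj_on (insert a) ?G"
    using assms by (auto simp: inj_on_def)
  ultimately have "card {X \<in> F. a \<in> X} = card ?G"
    by (simp add: card_image)
  moreover have "card F = card ({X \<in> F. a \<notin> X} \<union> {X \<in> F. a \<in> X})"
    by (rule arg_cong[where f = card]) auto
  moreover have "\<dots> = card {X \<in> F. a \<notin> X} + card {X \<in> F. a \<in> X}"
    using fin by (intro card_Un_disjoint) auto
  ultimately show ?thesis by simp
qed

text \<open>\<open>k\<close> and \<open>t\<close> locate a size between two consecutive balls;
  fractional \<open>t\<close> arises for the sections in the induction and for half of an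
  even-dimensional cube. Assuming only a lower bound on \<open>card F\<close> builds monotonicity
  into the statement. Nonemptiness excludes \<open>k = 0\<close>, \<open>t = 0\<close>, where the
  bound is 1.\<close>

theorem up_nbhd_card_ge:
  fixes t :: real
  assumes "finite S" "F \<subseteq> Pow S" "down_closed F" "F \<noteq> {}"
    and "0 \<le> t" "t \<le> 1"
    and "hamming_ball_card (card S) k + t * (card S choose k) \<le> card F"
  shows "hamming_ball_card (card S) (Suc k) + t * (card S choose Suc k) \<le> card (up_nbhd S F)"
  using assms
proof (induction S arbitrary: F k t rule: finite_induct)
  case empty
  then have "F = {{}}" by auto
  then show ?case
    by (simp add: up_nbhd_def hamming_ball_card_empty_cube)
next
  case (insert a S)
  define n where "n = card S"
  define F0 where "F0 = {X \<in> F. a \<notin> X}"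
  define F1 where "F1 = {X. X \<subseteq> S \<and> insert a X \<in> F}"
  have n: "card (insert a S) = Suc n"
    using insert by (simp add: n_def)
  have down: "Y \<in> F" if "X \<in> F" "Y \<subseteq> X" for X Y
    using that insert.prems(2) unfolding down_closed_def by blast
  have F0: "F0 \<subseteq> Pow S" "down_closed F0"
    using insert.prems down by (auto simp: F0_def down_closed_def)
  have F1: "F1 \<subseteq> Pow S" "down_closed F1"
    using down by (auto simp: F1_def down_closed_def) (meson insert_mono)
  have F1F0: "F1 \<subseteq> F0"
    using down insert.hyps by (auto simp: F1_def F0_def)
  have "{} \<in> F0"
    using insert.prems(3) down by (auto simp: F0_def)
  then have F0ne: "F0 \<noteq> {}" by auto
  have finS: "finite (Pow S)" using insert.hyps by simp
  note fin = finite_subset[OF _ finS]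
  have cF: "card F = card F0 + card F1"
    unfolding F0_def F1_def using insert by (intro card_family_insert) auto
  have NS: "up_nbhd (insert a S) F \<subseteq> Pow (insert a S)"
    using insert.prems by (intro up_nbhd_subset_Pow)
  have cN: "card (up_nbhd (insert a S) F) = card {X \<in> up_nbhd (insert a S) F. a \<notin> X}
      + card {X. X \<subseteq> S \<and> insert a X \<in> up_nbhd (insert a S) F}"
    using insert.hyps NS by (intro card_family_insert)
  have N0: "card (up_nbhd S F0) \<le> card {X \<in> up_nbhd (insert a S) F. a \<notin> X}"
  proof (rule card_mono)
    show "finite {X \<in> up_nbhd (insert a S) F. a \<notin> X}"
      using finite_subset[OF NS] insert.hyps by simp
    show "up_nbhd S F0 \<subseteq> {X \<in> up_nbhd (insert a S) F. a \<notin> X}"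
      using insert.hyps by (auto simp: up_nbhd_def F0_def)
  qed
  have finN1: "finite {X. X \<subseteq> S \<and> insert a X \<in> up_nbhd (insert a S) F}"
    using insert.hyps by auto
  have N1: "card (up_nbhd S F1) \<le> card {X. X \<subseteq> S \<and> insert a X \<in> up_nbhd (insert a S) F}"
  proof (rule card_mono[OF finN1])
    show "up_nbhd S F1 \<subseteq> {X. X \<subseteq> S \<and> insert a X \<in> up_nbhd (insert a S) F}"
    proof
      fix Y assume Y: "Y \<in> up_nbhd S F1"
      then have "Y \<subseteq> S" using up_nbhd_subset_Pow[OF F1(1)] by auto
      moreover have "insert a Y \<in> up_nbhd (insert a S) F"
        using Y by (auto simp: up_nbhd_def F1_def insert_commute) blast
      ultimately show "Y \<in> {X. X \<subseteq> S \<and> insert a X \<in> up_nbhd (insert a S) F}" by simp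
    qed
  qed
  \<comment> \<open>Inserting \<open>a\<close> into a member of \<open>F0\<close> is itself an
    upward step, so the upper half of the neighbourhood contains a copy of
    \<open>F0\<close>.\<close>
  have N1': "card F0 \<le> card {X. X \<subseteq> S \<and> insert a X \<in> up_nbhd (insert a S) F}"
    using F0(1) by (intro card_mono[OF finN1]) (auto simp: up_nbhd_def F0_def)
  have N01: "real (card (up_nbhd S F0)) + real (card (up_nbhd S F1)) \<le> card (up_nbhd (insert a S) F)"
    and N00: "real (card (up_nbhd S F0)) + real (card F0) \<le> card (up_nbhd (insert a S) F)"
    unfolding cN using N0 N1 N1' by (auto intro: add_mono)
  have le: "card F1 \<le> card F0"
    using F1F0 fin[OF F0(1)] by (rule card_mono[rotated])
  \<comment> \<open>Stated for layer \<open>Suc k\<close>, so that Pascal's rule splits it into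
    layers \<open>k\<close> and \<open>Suc k\<close> one dimension lower. Layer 0 is reduced to it
    at the end.\<close>
  have step: "hamming_ball_card (Suc n) (Suc (Suc k)) + t * (Suc n choose Suc (Suc k))
      \<le> card (up_nbhd (insert a S) F)"
    if t: "0 \<le> t" "t \<le> 1"
      and m: "hamming_ball_card (Suc n) (Suc k) + t * (Suc n choose Suc k) \<le> card F" for k and t :: real
  proof -
    \<comment> \<open>Sizes are measured from the ball size \<open>D\<close>, where the bound
      changes slope from \<sigma> to \<tau>. The extremal family has sections of sizes
      \<open>D + z0\<close> and \<open>D + z1\<close>, by Pascal's rule.\<close>
    define D where "D = real (hamming_ball_card n (Suc k))"
    define \<sigma> where "\<sigma> = real (n - k) / real (Suc k)"
    define \<tau> where "\<tau> = real (n - Suc k) / real (Suc (Suc k))"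
    define c where "c = real (n choose k)"
    define z1 where "z1 = - (1 - t) * c"
    define z0 where "z0 = t * (\<sigma> * c)"
    have \<sigma>\<tau>: "0 \<le> \<tau>" "\<tau> \<le> \<sigma>" "0 \<le> c"
      using choose_ratio_antimono[of n k] by (simp_all add: \<sigma>_def \<tau>_def c_def)
    have c1: "real (n choose Suc k) = \<sigma> * c" and c2: "real (n choose Suc (Suc k)) = \<tau> * (\<sigma> * c)"
      using choose_Suc_ratio[of n k] choose_Suc_ratio[of n "Suc k"]
      by (simp_all add: \<sigma>_def \<tau>_def c_def)
    have z: "z1 \<le> 0" "0 \<le> z0"
      using t \<sigma>\<tau> by (auto simp: z1_def z0_def intro: mult_nonpos_nonneg)
    have Dk: "real (hamming_ball_card n k) = D - c"
      by (simp add: D_def c_def hamming_ball_card_Suc)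
    have DSk: "real (hamming_ball_card n (Suc (Suc k))) = D + \<sigma> * c"
      using c1 by (simp add: D_def hamming_ball_card_Suc[of n "Suc k"])
    have DSSk: "real (hamming_ball_card n (Suc (Suc (Suc k)))) = D + \<sigma> * c + \<tau> * (\<sigma> * c)"
      using DSk c2 by (simp add: hamming_ball_card_Suc[of n "Suc (Suc k)"])
    have m': "2 * D + z0 + z1 \<le> real (card F0) + real (card F1)"
      using m unfolding cF hamming_ball_card_pascal binomial_Suc_Suc of_nat_add c1 Dk
      by (simp add: D_def[symmetric] c_def[symmetric] z0_def z1_def algebra_simps)
    have goal: "real (hamming_ball_card (Suc n) (Suc (Suc k))) + t * real (Suc n choose Suc (Suc k))
        = 2 * (D + \<sigma> * c) + \<tau> * z0 + \<sigma> * z1"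
      unfolding hamming_ball_card_pascal binomial_Suc_Suc of_nat_add c1 c2 DSk
      by (simp add: D_def[symmetric] z0_def z1_def algebra_simps)
    show ?thesis
    proof (cases "D + z0 \<le> card F0")
      case True
      then have "D + \<sigma> * c + t * (\<tau> * (\<sigma> * c)) \<le> card (up_nbhd S F0)"
        using insert.IH[OF F0 F0ne t, of "Suc k"]
        unfolding n_def[symmetric] c1 c2 DSk by (simp add: D_def z0_def)
      moreover have "t * (\<tau> * (\<sigma> * c)) = \<tau> * z0"
        by (simp add: z0_def)
      ultimately have "D + \<sigma> * c + \<tau> * z0 \<le> card (up_nbhd S F0)"
        by (simp only:)
      \<comment> \<open>Since \<open>\<sigma> * c + \<sigma> * z1 = z0\<close>, the bound for the
        smaller extremal section is exactly the size of the larger one. A copy of \<open>F0\<close>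
        therefore replaces the neighbourhood of \<open>F1\<close>.\<close>
      moreover have "D + \<sigma> * c + \<sigma> * z1 \<le> card F0"
        using True by (simp add: z1_def z0_def algebra_simps)
      ultimately show ?thesis
        unfolding goal distrib_left mult_2 using N00 by linarith
    next
      case False
      define y0 where "y0 = card F0 - D"
      define y1 where "y1 = card F1 - D"
      have y: "z1 \<le> y1" "y1 \<le> y0" "y0 \<le> z0" "z0 + z1 \<le> y0 + y1"
        using False m' le by (auto simp: y0_def y1_def)
      \<comment> \<open>As \<open>F0\<close> falls short of \<open>D + z0\<close>, \<open>F1\<close>
        must exceed \<open>D + z1\<close>, which is nonnegative because \<open>D - c\<close> is a
        ball size. So the induction hypothesis applies to \<open>F1\<close>.\<close>
      have "real (card F1) > D - c + t * c"
        using False m' by (simp add: z1_def algebra_simps)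
      moreover have "D - c \<ge> 0" using Dk by (metis of_nat_0_le_iff)
      ultimately have "real (card F1) > 0"
        using t \<sigma>\<tau> by (smt (verit) mult_nonneg_nonneg)
      then have F1ne: "F1 \<noteq> {}" by auto
      \<comment> \<open>Sizes in \<open>[D + z1, D + z0]\<close> lie within the two layers adjacent
        to \<open>D\<close>; the induction hypothesis at \<open>k\<close> and at
        \<open>Suc k\<close> covers the two linear pieces.\<close>
      have piece: "D + \<sigma> * c + (if real (card G) - D \<le> 0 then \<sigma> else \<tau>) * (real (card G) - D)
          \<le> card (up_nbhd S G)"
        if G: "G \<subseteq> Pow S" "down_closed G" "G \<noteq> {}"
          and lo: "z1 \<le> real (card G) - D" and hi: "real (card G) - D \<le> z0" for G
      proof (cases "real (card G) - D \<le> 0")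
        case True
        \<comment> \<open>Chosen to solve \<open>u * c = card G - D + c\<close>. If
          \<open>c = 0\<close>, both sides vanish, because
          \<open>- c \<le> card G - D \<le> 0\<close>, and 1 is an admissible value.\<close>
        define u where "u = (if c = 0 then 1 else 1 + (card G - D) / c)"
        have "- c \<le> z1"
          using t \<sigma>\<tau> by (simp add: z1_def algebra_simps)
        then have lo': "- c \<le> card G - D" using lo by simp
        then have u: "0 \<le> u" "u \<le> 1" "u * c = card G - D + c"
          using True \<sigma>\<tau> by (auto simp: u_def field_simps)
        have "D + u * (\<sigma> * c) \<le> card (up_nbhd S G)"
          using insert.IH[OF G u(1,2), of k] u(3)
          unfolding n_def[symmetric] c1 Dk c_def[symmetric] by (simp add: D_def)
        moreover have "u * (\<sigma> * c) = \<sigma> * (card G - D + c)"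
          unfolding u(3)[symmetric] by simp
        ultimately show ?thesis
          using True by (simp add: algebra_simps)
      next
        case False
        define u where "u = (card G - D) / (\<sigma> * c)"
        have "z0 \<le> \<sigma> * c"
          using t \<sigma>\<tau> by (simp add: z0_def mult_left_le_one_le)
        then have hi': "card G - D \<le> \<sigma> * c" using hi by simp
        then have u: "0 \<le> u" "u \<le> 1" "u * (\<sigma> * c) = card G - D"
          using False by (auto simp: u_def pos_divide_le_eq)
        have "D + \<sigma> * c + u * (\<tau> * (\<sigma> * c)) \<le> card (up_nbhd S G)"
          using insert.IH[OF G u(1,2), of "Suc k"] u(3)
          unfolding n_def[symmetric] c1 c2 DSk by (simp add: D_def)
        moreover have "u * (\<tau> * (\<sigma> * c)) = \<tau> * (card G - D)"
          unfolding u(3)[symmetric] by simp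
        ultimately show ?thesis
          using False by simp
      qed
      have "D + \<sigma> * c + (if y0 \<le> 0 then \<sigma> else \<tau>) * y0 \<le> card (up_nbhd S F0)"
        using piece[OF F0 F0ne] y by (simp add: y0_def)
      moreover have "D + \<sigma> * c + (if y1 \<le> 0 then \<sigma> else \<tau>) * y1 \<le> card (up_nbhd S F1)"
        using piece[OF F1 F1ne] y by (simp add: y1_def)
      moreover note concave_two_piece[OF \<sigma>\<tau>(1,2) z y]
      ultimately show ?thesis
        unfolding goal distrib_left mult_2 using N01 by linarith
    qed
  qed
  show ?case
  proof (cases k)
    case 0
    \<comment> \<open>A nonempty family already has the size of the one-point ball, so
      \<open>step\<close> with \<open>t = 0\<close> gives the bound \<open>1 + Suc n\<close>, enough
      for every \<open>t \<le> 1\<close>.\<close>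
    have "card F \<ge> 1"
      using F0ne fin[OF F0(1)] cF by (metis One_nat_def Suc_leI card_gt_0_iff trans_le_add1)
    then have "1 + real (Suc n) \<le> card (up_nbhd (insert a S) F)"
      using step[of 0 0] by (simp add: hamming_ball_card_Suc)
    moreover have "t * real (Suc n) \<le> real (Suc n)"
      using insert.prems by (intro mult_left_le_one_le) auto
    ultimately have "1 + t * real (Suc n) \<le> card (up_nbhd (insert a S) F)"
      by linarith
    then show ?thesis
      unfolding n 0 by (simp add: hamming_ball_card_Suc)
  next
    case (Suc k')
    then show ?thesis
      using step insert.prems unfolding n by blast
  qed
qed

section \<open>Central binomial coefficients and Wallis' product\<close>

lemma central_choose_Suc:
  "Suc m * (2 * Suc m choose Suc m) = 2 * (2 * m + 1) * (2 * m choose m)"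
proof -
  have "Suc m * (Suc (2*m) choose Suc m) = (2 * m + 1) * (2 * m choose m)"
    using Suc_times_binomial[of m "2*m"] by simp
  moreover have "(Suc (2*m) choose m) = (Suc (2*m) choose Suc m)"
    using binomial_symmetric[of m "Suc (2*m)"] by (simp add: Suc_diff_le)
  ultimately show ?thesis by (simp add: algebra_simps)
qed

text \<open>The factor of index \<open>m + 1\<close> has denominator
  \<open>(2m + 1)(2m + 3)\<close>; it cancels against the ratio of consecutive central coefficients
  and the change in the linear factor, leaving 16.\<close>

lemma wallis_product_central_choose:
  "(\<Prod>k=1..m. (4*real k^2) / (4*real k^2 - 1)) * (real (2 * m choose m))\<^sup>2 * (2 * real m + 1) = 16 ^ m"
proof (induction m)
  case (Suc m)
  let ?P = "\<Prod>k=1..m. (4*real k^2) / (4*real k^2 - 1)"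
  let ?M = "real m + 1"
  have c: "real (2 * Suc m choose Suc m) = 2 * (2 * real m + 1) / ?M * real (2 * m choose m)"
    using arg_cong[OF central_choose_Suc[of m], of real]
    by (simp add: field_simps del: binomial_Suc_Suc mult_Suc_right)
  have f: "4 * ?M^2 - 1 = (2 * real m + 1) * (2 * real m + 3)"
    by (simp add: power2_eq_square algebra_simps)
  have P: "(\<Prod>k=1..Suc m. (4*real k^2) / (4*real k^2 - 1))
      = ?P * ((4 * ?M^2) / ((2 * real m + 1) * (2 * real m + 3)))"
    unfolding f[symmetric] by (simp add: add.commute)
  \<comment> \<open>The cancellation is done for abstract positive \<open>u\<close>,
    \<open>v\<close>, \<open>w\<close> and then instantiated.\<close>
  have "4 * w\<^sup>2 / (u * v) * (2 * u / w * b)\<^sup>2 * v = 16 * b\<^sup>2 * u"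
    if "u > 0" "v > 0" "w > 0" for u v w b :: real
    using that by (simp add: power2_eq_square field_simps)
  from this[of "2 * real m + 1" "2 * real m + 3" ?M "real (2 * m choose m)"]
  have "4 * ?M\<^sup>2 / ((2 * real m + 1) * (2 * real m + 3)) * (2 * (2 * real m + 1) / ?M * real (2 * m choose m))\<^sup>2
      * (2 * real (Suc m) + 1) = 16 * (real (2 * m choose m))\<^sup>2 * (2 * real m + 1)"
    by (simp add: add_ac)
  then have "(\<Prod>k=1..Suc m. (4*real k^2) / (4*real k^2 - 1)) * (real (2 * Suc m choose Suc m))\<^sup>2 * (2 * real (Suc m) + 1)
     = ?P * (16 * (real (2 * m choose m))\<^sup>2 * (2 * real m + 1))"
    unfolding P c by (simp only: mult.assoc)
  also have "\<dots> = 16 * (?P * (real (2 * m choose m))\<^sup>2 * (2 * real m + 1))"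
    by (simp only: mult_ac)
  finally show ?case using Suc by simp
qed simp

text \<open>The partial Wallis products increase to \<open>pi / 2\<close>, so each is at most
  \<open>pi / 2\<close>; the exact identity turns this into a lower bound on the
  coefficient.\<close>

lemma central_choose_lower_bound:
  "4 ^ m * sqrt (2 / (pi * (2 * real m + 1))) \<le> real (2 * m choose m)"
proof -
  let ?f = "\<lambda>k. (4*real k^2) / (4*real k^2 - 1)"
  let ?P = "\<lambda>m. \<Prod>k=1..m. ?f k"
  have ge: "?f k \<ge> 1" if "k \<ge> 1" for k
  proof -
    have "real k ^ 2 \<ge> 1" using that by simp
    then show ?thesis by (simp add: field_simps)
  qed
  have pos: "?P m \<ge> 0" for m
    using ge by (intro prod_nonneg) (meson atLeastAtMost_iff order_trans zero_le_one)
  have "incseq ?P"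
  proof (rule incseq_SucI)
    fix m
    show "?P m \<le> ?P (Suc m)"
      using mult_left_mono[OF ge[of "Suc m"] pos[of m]] by simp
  qed
  then have P: "?P m \<le> pi / 2"
    using wallis by (rule incseq_le)
  have "16 ^ m \<le> pi / 2 * (real (2 * m choose m))\<^sup>2 * (2 * real m + 1)"
    unfolding wallis_product_central_choose[of m, symmetric]
    by (intro mult_right_mono P) auto
  then have "16 ^ m * (2 / (pi * (2 * real m + 1))) \<le> (real (2 * m choose m))\<^sup>2"
    by (simp add: pos_divide_le_eq pi_gt_zero mult_pos_pos) (simp add: algebra_simps)
  moreover have "(4 ^ m)\<^sup>2 = (16::real) ^ m"
    by (simp add: power_mult[symmetric] power2_eq_square power_mult_distrib[symmetric])
  ultimately have "(4 ^ m * sqrt (2 / (pi * (2 * real m + 1))))\<^sup>2 \<le> (real (2 * m choose m))\<^sup>2"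
    by (simp add: power_mult_distrib)
  then show ?thesis
    by (rule power2_le_imp_le) simp
qed

section \<open>The boundary of a down-set filling half the cube\<close>

lemma hamming_ball_card_odd: "hamming_ball_card (2 * p + 1) (Suc p) = 4 ^ p"
proof -
  have "hamming_ball_card (2 * p + 1) (Suc p) = (\<Sum>k\<le>p. (2 * p + 1) choose k)"
    by (simp add: hamming_ball_card_def lessThan_Suc_atMost)
  then show ?thesis using binomial_r_part_sum[of p] by (simp add: power_mult)
qed

lemma hamming_ball_card_even:
  assumes "p > 0"
  shows "2 * hamming_ball_card (2 * p) p + (2 * p choose p) = 4 ^ p"
proof -
  have "hamming_ball_card (2 * p + 1) (Suc p) = 2 * hamming_ball_card (2 * p) p + (2 * p choose p)"
    by (simp add: hamming_ball_card_pascal hamming_ball_card_Suc[of "2*p"])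
  then show ?thesis using hamming_ball_card_odd[of p] by simp
qed

text \<open>The even number \<open>2 * m\<close> just above \<open>n\<close> puts both parities into
  one formula. For odd \<open>n\<close> half the cube is a ball; for even \<open>n\<close> it lies
  halfway through the middle layer.\<close>

lemma half_cube_boundary:
  assumes S: "finite S" "card S = n" and F: "F \<subseteq> Pow S" "down_closed F" "F \<noteq> {}"
    and half: "2 * card F = 2 ^ n" and m: "n + 1 = 2 * m \<or> n + 2 = 2 * m" and n: "n > 0"
  shows "2 ^ n * real (2 * m choose m) \<le> 4 ^ m * real (card (up_nbhd S F - F))"
proof -
  have "finite (up_nbhd S F)" "F \<subseteq> up_nbhd S F"
    using finite_subset[OF up_nbhd_subset_Pow[OF F(1)]] S by (auto simp: up_nbhd_def)
  then have B: "real (card (up_nbhd S F - F)) = real (card (up_nbhd S F)) - card F"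
    by (simp add: card_Diff_subset card_mono finite_subset of_nat_diff)
  obtain p where p: "m = Suc p" using m n by (cases m) auto
  have "2 * p + 2 choose (p + 1) = (2 * p + 1 choose Suc p) + (2 * p + 1 choose p)"
    by simp
  moreover have "2 * p + 1 choose p = (2 * p + 1 choose Suc p)"
    using binomial_symmetric[of p "2 * p + 1"] by (simp add: Suc_diff_le del: binomial_Suc_Suc)
  ultimately have central: "2 * m choose m = 2 * (2 * p + 1 choose Suc p)"
    using p by (simp del: binomial_Suc_Suc)
  show ?thesis
  proof (cases "n = 2 * p + 1")
    case True
    have cF: "card F = 4 ^ p"
      using half True by (simp add: power_mult)
    have "real (card (up_nbhd S F)) \<ge> hamming_ball_card n (Suc (Suc p))"
      using up_nbhd_card_ge[OF S(1) F, of 0 "Suc p"] S(2) True cF hamming_ball_card_odd[of p] by simp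
    then have "real (card (up_nbhd S F - F)) \<ge> (2 * p + 1 choose Suc p)"
      unfolding B using True cF hamming_ball_card_odd[of p]
      by (simp add: hamming_ball_card_Suc[of _ "Suc p"] del: binomial_Suc_Suc)
    moreover have "(2::real) ^ n * 2 = 4 ^ m"
      using True p by (simp add: power_mult)
    ultimately show ?thesis
      unfolding central by (simp add: mult.assoc[symmetric] del: binomial_Suc_Suc)
  next
    case False
    then have n2: "n = 2 * p" and "p > 0" using m p n by auto
    have cF: "2 * card F = 4 ^ p"
      using half n2 by (simp add: power_mult)
    \<comment> \<open>Half the middle layer belongs to the extremal family, hence
      \<open>t = 1/2\<close>.\<close>
    then have h: "real (hamming_ball_card n p) + 1/2 * real (n choose p) = card F"
      using arg_cong[OF hamming_ball_card_even[OF \<open>p > 0\<close>], of real] arg_cong[OF cF, of real] n2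
    by simp
    then have "real (hamming_ball_card n (Suc p)) + 1/2 * real (n choose Suc p) \<le> card (up_nbhd S F)"
      using up_nbhd_card_ge[OF S(1) F, of "1/2" p] S(2) by simp
    \<comment> \<open>The difference of the two bounds is half of the sum of layers \<open>p\<close>
      and \<open>Suc p\<close>, which Pascal's rule merges into one coefficient of dimension
      \<open>2 * p + 1\<close>.\<close>
    then have "2 * real (card (up_nbhd S F - F)) \<ge> (2 * p + 1 choose Suc p)"
      unfolding B using h n2 by (simp add: hamming_ball_card_Suc)
    then have "2 ^ n * (2 * real (2 * p + 1 choose Suc p)) \<le> 2 ^ n * (4 * real (card (up_nbhd S F - F)))"
      by (intro mult_left_mono) auto
    moreover have "(2::real) ^ n * 4 = 4 ^ m"
      using n2 p by (simp add: power_mult)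
    ultimately show ?thesis
      unfolding central by (simp add: mult.assoc[symmetric] del: binomial_Suc_Suc)
  qed
qed

section \<open>From distinct subset sums to a small boundary\<close>

lemma card_half_sum_family:
  fixes a :: "nat \<Rightarrow> nat"
  assumes d: "distinct_subset_sums n a" and n: "n > 0"
  shows "2 * card {X. X \<subseteq> {1..n} \<and> 2 * sum a X < sum a {1..n}} = 2 ^ n"
proof -
  let ?S = "{1..n}"
  let ?F = "{X. X \<subseteq> ?S \<and> 2 * sum a X < sum a ?S}"
  have split: "sum a ?S = sum a (?S - X) + sum a X" if "X \<subseteq> ?S" for X
    using that by (simp add: sum.subset_diff)
  have "X \<noteq> ?S - X" if "X \<subseteq> ?S" for X
  proof -
    have "1 \<in> ?S" using n by simp
    then show ?thesis by blast
  qed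
  \<comment> \<open>No sum equals exactly half the total, since a set and its complement are
    distinct and so have different sums.\<close>
  then have ne: "sum a X \<noteq> sum a (?S - X)" if "X \<subseteq> ?S" for X
    using d that unfolding distinct_subset_sums_def by (metis Diff_subset)
  \<comment> \<open>Complementation exchanges the sums below and above half the total, so the two
    classes have equal size.\<close>
  have "Pow ?S - ?F = (\<lambda>X. ?S - X) ` ?F"
  proof
    show "Pow ?S - ?F \<subseteq> (\<lambda>X. ?S - X) ` ?F"
    proof
      fix X assume X: "X \<in> Pow ?S - ?F"
      then have "?S - X \<in> ?F" using split[of X] ne[of X] by auto
      moreover have "X = ?S - (?S - X)" using X by auto
      ultimately show "X \<in> (\<lambda>X. ?S - X) ` ?F" by blast
    qed
    show "(\<lambda>X. ?S - X) ` ?F \<subseteq> Pow ?S - ?F"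
    proof
      fix Y assume "Y \<in> (\<lambda>X. ?S - X) ` ?F"
      then obtain X where "X \<in> ?F" "Y = ?S - X" by blast
      then show "Y \<in> Pow ?S - ?F" using split[of X] by auto
    qed
  qed
  moreover have "inj_on (\<lambda>X. ?S - X) ?F"
    by (auto simp: inj_on_def)
  ultimately have "card (Pow ?S - ?F) = card ?F"
    by (simp add: card_image)
  moreover have "card (Pow ?S - ?F) = 2 ^ n - card ?F" "card ?F \<le> card (Pow ?S)"
    by (subst card_Diff_subset; auto simp: card_Pow) (intro card_mono; auto)
  ultimately show ?thesis by (simp add: card_Pow)
qed

text \<open>A boundary set arises by adding one element, of value at most \<open>a n\<close>, to a
  set below half the total. Its sum thus falls in a window of \<open>a n\<close> consecutive
  integers, and distinct boundary sets have distinct sums.\<close>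

lemma boundary_le_max:
  fixes a :: "nat \<Rightarrow> nat"
  assumes mono: "strict_mono_on {1..n} a" and d: "distinct_subset_sums n a"
    and F: "F = {X. X \<subseteq> {1..n} \<and> 2 * sum a X < sum a {1..n}}"
  shows "card (up_nbhd {1..n} F - F) \<le> a n"
proof -
  let ?T = "sum a {1..n}"
  \<comment> \<open>Half the total rounded up: a sum is below \<open>l\<close> exactly when its
    double is below the total, for either parity.\<close>
  define l where "l = (?T + 1) div 2"
  have sub: "up_nbhd {1..n} F \<subseteq> Pow {1..n}"
    using F by (intro up_nbhd_subset_Pow) auto
  have "inj_on (sum a) (up_nbhd {1..n} F - F)"
    using d sub unfolding distinct_subset_sums_def inj_on_def by blast
  moreover have "sum a ` (up_nbhd {1..n} F - F) \<subseteq> {l..<l + a n}"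
  proof
    fix s assume "s \<in> sum a ` (up_nbhd {1..n} F - F)"
    then obtain x X where x: "x \<in> {1..n}" and X: "X \<in> F" and s: "s = sum a (insert x X)"
      and nF: "insert x X \<notin> F"
      by (auto simp: up_nbhd_def)
    have "x \<notin> X" using X nF by (metis insert_absorb)
    moreover have "finite X" using X F by (auto intro: finite_subset)
    ultimately have sX: "s = a x + sum a X" by (simp add: s)
    have "a x \<le> a n"
    proof (cases "x = n")
      case False
      then show ?thesis using strict_mono_onD[OF mono, of x n] x by auto
    qed simp
    moreover have "2 * sum a X < ?T" "?T \<le> 2 * s"
      using X nF x F s by auto
    ultimately show "s \<in> {l..<l + a n}"
      using sX by (auto simp: l_def)
  qed
  ultimately have "card (up_nbhd {1..n} F - F) \<le> card {l..<l + a n}"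
    by (intro card_inj_on_le) auto
  then show ?thesis by simp
qed

text \<open>An explicit bound for every positive \<open>n\<close>; the shift by 3 comes from
  \<open>2 * m + 1 \<le> n + 3\<close>, which covers both parities.\<close>

lemma distinct_subset_sums_max_ge:
  fixes a :: "nat \<Rightarrow> nat"
  assumes mono: "strict_mono_on {1..n} a"
    and d: "distinct_subset_sums n a" and n: "n > 0"
  shows "2 ^ n * sqrt (2 / (pi * (real n + 3))) \<le> a n"
proof -
  define F where "F = {X. X \<subseteq> {1..n} \<and> 2 * sum a X < sum a {1..n}}"
  have half: "2 * card F = 2 ^ n"
    using card_half_sum_family[OF d n] by (simp add: F_def)
  have Fne: "F \<noteq> {}"
    using half by auto
  have down: "down_closed F"
    unfolding down_closed_def
  proof (intro ballI allI impI)
    fix X Y assume X: "X \<in> F" and Y: "Y \<subseteq> X"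
    then have "finite X" by (auto simp: F_def intro: finite_subset)
    then have "sum a Y \<le> sum a X" using Y by (intro sum_mono2) auto
    then show "Y \<in> F" using X Y by (auto simp: F_def)
  qed
  define m where "m = (n + 2) div 2"
  have m: "n + 1 = 2 * m \<or> n + 2 = 2 * m" unfolding m_def by presburger
  have "2 ^ n * real (2 * m choose m) \<le> 4 ^ m * real (card (up_nbhd {1..n} F - F))"
    by (rule half_cube_boundary[OF _ _ _ down Fne half m n]) (auto simp: F_def)
  also have "\<dots> \<le> 4 ^ m * real (a n)"
    using boundary_le_max[OF mono d F_def] by simp
  finally have "2 ^ n * real (2 * m choose m) \<le> 4 ^ m * real (a n)" .
  moreover have "2 ^ n * (4 ^ m * sqrt (2 / (pi * (2 * real m + 1)))) \<le> 2 ^ n * real (2 * m choose m)"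
    by (intro mult_left_mono central_choose_lower_bound) auto
  ultimately have "4 ^ m * (2 ^ n * sqrt (2 / (pi * (2 * real m + 1)))) \<le> 4 ^ m * real (a n)"
    by (simp only: mult.left_commute)
  then have "2 ^ n * sqrt (2 / (pi * (2 * real m + 1))) \<le> real (a n)"
    by simp
  moreover have "sqrt (2 / (pi * (real n + 3))) \<le> sqrt (2 / (pi * (2 * real m + 1)))"
  proof (intro real_sqrt_le_mono divide_left_mono mult_left_mono)
    have "2 * m \<le> n + 2" using m by auto
    then show "2 * real m + 1 \<le> real n + 3" by linarith
  qed (auto intro!: mult_pos_pos)
  ultimately show ?thesis
    by (smt (verit) mult_left_mono zero_le_power)
qed

section \<open>Passage from the explicit bound to the asymptotic one\<close>

theorem corollary2:
  fixes \<eta> :: real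
  assumes "\<eta> > 0"
  shows "\<exists>N. \<forall>n\<ge>N. \<forall>a :: nat \<Rightarrow> nat.
           (\<forall>i\<in>{1..n}. a i > 0) \<longrightarrow> strict_mono_on {1..n} a \<longrightarrow> distinct_subset_sums n a \<longrightarrow>
             real (a n) \<ge> (1 - \<eta>) * sqrt (2 / pi) * (2 ^ n / sqrt (real n))"
proof -
  \<comment> \<open>This factor is the ratio of the explicit bound to the claimed main term, so it
    alone has to absorb \<eta>.\<close>
  have "(\<lambda>n. sqrt (real n / (real n + 3))) \<longlonglongrightarrow> 1"
    by real_asymp
  then have "\<forall>\<^sub>F n in sequentially. 1 - \<eta> < sqrt (real n / (real n + 3))"
    using assms by (intro order_tendstoD) auto
  then obtain N where N: "1 - \<eta> < sqrt (real n / (real n + 3))" if "n \<ge> N" for n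
    by (auto simp: eventually_sequentially)
  show ?thesis
  \<comment> \<open>\<open>Suc N\<close> in place of \<open>N\<close> ensures
    \<open>n > 0\<close>.\<close>
  proof (intro exI[of _ "Suc N"] allI impI)
    fix n and a :: "nat \<Rightarrow> nat"
    assume n: "n \<ge> Suc N" and a: "strict_mono_on {1..n} a"
      "distinct_subset_sums n a"
    have "(1 - \<eta>) * sqrt (2 / pi) * (2 ^ n / sqrt (real n))
        \<le> sqrt (real n / (real n + 3)) * sqrt (2 / pi) * (2 ^ n / sqrt (real n))"
      using N[of n] n by (intro mult_right_mono) auto
    also have "\<dots> = 2 ^ n * sqrt (2 / (pi * (real n + 3)))"
      using n by (simp add: real_sqrt_divide real_sqrt_mult mult_ac)
    also have "\<dots> \<le> a n"
      using distinct_subset_sums_max_ge[OF a] n by simp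
    finally show "real (a n) \<ge> (1 - \<eta>) * sqrt (2 / pi) * (2 ^ n / sqrt (real n))" .
  qed
qed

end
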